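(* Let $X,Y\subseteq\mathbb{N}$, let $n\ge1$ and $s\ge0$ be integers. Then $$P_{n,s}^{X,Y}=|X_n^c|!\sum_{r=0}^{s}(-1)^{s-r}\binom{|X_n^c|+r}{r}\binom{n+1}{s-r}\prod_{x\in X_n}\bigl(1+r+\alpha_{X,n,x}+\beta_{Y,n,x}\bigr).$$
   Context: $\mathbb{N}=\{1,2,\dots\}$, $S_n$ is the set of permutations $\sigma=\sigma_1\cdots\sigma_n$ of $[n]=\{1,\dots,n\}$. For $X,Y\subseteq\mathbb{N}$, an $X,Y$-descent of $\sigma$ is an index $i$ with $\sigma_i>\sigma_{i+1}$, $\sigma_i\in X$, $\sigma_{i+1}\in Y$; $des_{X,Y}(\sigma)$ is the number of such $i$, and $P_{n,s}^{X,Y}$ is the number of $\sigma\in S_n$ with $des_{X,Y}(\sigma)=s$. For $S\subseteq\mathbb{N}$: $S_n=S\cap[n]$, $S_n^c=[n]\setminus S$, and for $1\le j\le n$, $\alpha_{S,n,j}=|\{z: j<z\le n,\ z\notin S\}|$ and $\beta_{S,n,j}=|\{z:1\le z<j,\ z\notin S\}|$. *)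

theory Defs
  imports "HOL-Combinatorics.Permutations"
begin

text \<open>
  The set of positive integers is rendered as \<^term>\<open>{1..} :: nat set\<close>, and a permutation
  of \<^term>\<open>{1..n::nat}\<close> as a function \<open>\<sigma>\<close> with \<open>\<sigma> permutes {1..n}\<close> (thus the identity
  outside \<^term>\<open>{1..n::nat}\<close>), so that \<open>\<sigma> i\<close> is the \<open>i\<close>-th letter of its one-line notation.
\<close>

definition des :: "nat set \<Rightarrow> nat set \<Rightarrow> nat \<Rightarrow> (nat \<Rightarrow> nat) \<Rightarrow> nat" where
  "des X Y n \<sigma> =
     card {i. 1 \<le> i \<and> i < n \<and> \<sigma> i > \<sigma> (i + 1) \<and> \<sigma> i \<in> X \<and> \<sigma> (i + 1) \<in> Y}"

definition P :: "nat set \<Rightarrow> nat set \<Rightarrow> nat \<Rightarrow> nat \<Rightarrow> nat" where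
  "P X Y n s = card {\<sigma>. \<sigma> permutes {1..n} \<and> des X Y n \<sigma> = s}"

definition restr :: "nat set \<Rightarrow> nat \<Rightarrow> nat set" where
  "restr S n = S \<inter> {1..n}"

definition restr_compl :: "nat set \<Rightarrow> nat \<Rightarrow> nat set" where
  "restr_compl S n = {1..n} - S"

definition alpha :: "nat set \<Rightarrow> nat \<Rightarrow> nat \<Rightarrow> nat" where
  "alpha S n j = card {z. j < z \<and> z \<le> n \<and> z \<notin> S}"

text \<open>The argument \<open>n\<close> of \<open>beta\<close> is idle; it is kept to parallel \<open>alpha\<close>.\<close>

definition beta :: "nat set \<Rightarrow> nat \<Rightarrow> nat \<Rightarrow> nat" where
  "beta S n j = card {z. 1 \<le> z \<and> z < j \<and> z \<notin> S}"

end

theory Submission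
  imports
    Defs
    "HOL-Combinatorics.Multiset_Permutations"
    "HOL-Computational_Algebra.Formal_Power_Series"
begin

text \<open>
  Let \<open>p\<^sub>n(t)\<close> be the generating polynomial of the descent statistic over the permutations of
  \<open>{1..n}\<close>, let \<open>y\<close> be the number of elements of \<open>Y\<close> among them, and let \<open>g\<^sub>n(t)\<close> be the power
  series whose \<open>r\<close>-th coefficient is the factor of the \<open>r\<close>-th summand that does not depend on \<open>s\<close>.
  The claim is \<open>p\<^sub>n = (1 - t)\<^sup>n\<^sup>+\<^sup>1 g\<^sub>n\<close>.
  Inserting the new maximum \<open>n + 1\<close> into a permutation gives
  \<open>p\<^sub>n\<^sub>+\<^sub>1 = (1 - t) p\<^sub>n' + (n + 1) p\<^sub>n\<close> if \<open>n + 1\<close> is not in \<open>X\<close>, as the new letter can only destroy a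
  descent, and \<open>p\<^sub>n\<^sub>+\<^sub>1 = t (1 - t) p\<^sub>n' + (y t + n + 1 - y) p\<^sub>n\<close> if it is in \<open>X\<close>, as the new
  letter then creates a descent exactly when it is put before an element of \<open>Y\<close> that is not yet a
  descent bottom. Under the substitution \<open>p\<^sub>n = (1 - t)\<^sup>n\<^sup>+\<^sup>1 g\<^sub>n\<close> these recurrences become
  \<open>g\<^sub>n\<^sub>+\<^sub>1 = g\<^sub>n'\<close> and \<open>g\<^sub>n\<^sub>+\<^sub>1 = t g\<^sub>n' + (n + 1 - y) g\<^sub>n\<close>, which are immediate on coefficients.
\<close>

subsection \<open>Descents of words and insertion of a maximal letter\<close>

text \<open>Lists, unlike functions, admit structural induction and insertion of a letter at a given
  place.\<close>

fun word_des :: "nat set \<Rightarrow> nat set \<Rightarrow> nat list \<Rightarrow> nat" where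
  "word_des X Y (x # y # zs) = of_bool (x > y \<and> x \<in> X \<and> y \<in> Y) + word_des X Y (y # zs)"
| "word_des X Y _ = 0"

definition insert_at :: "'a \<Rightarrow> nat \<Rightarrow> 'a list \<Rightarrow> 'a list" where
  "insert_at m i xs = take i xs @ m # drop i xs"

lemma insert_at_0 [simp]: "insert_at m 0 xs = m # xs"
  by (simp add: insert_at_def)

lemma insert_at_Nil [simp]: "insert_at m i [] = [m]"
  by (simp add: insert_at_def)

lemma insert_at_Suc_Cons [simp]: "insert_at m (Suc i) (x # xs) = x # insert_at m i xs"
  by (simp add: insert_at_def)

section \<open>Passage from permutations to words\<close>

lemma word_des_conv_sum:
  "word_des X Y xs =
     (\<Sum>i<length xs - 1. of_bool (xs ! i > xs ! Suc i \<and> xs ! i \<in> X \<and> xs ! Suc i \<in> Y))"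
  by (induction X Y xs rule: word_des.induct)
     (simp_all add: sum.lessThan_Suc_shift del: sum.lessThan_Suc)

lemma word_des_map_upt: "word_des X Y (map \<sigma> [1..<Suc n]) = des X Y n \<sigma>"
proof -
  let ?Q = "\<lambda>i. \<sigma> i > \<sigma> (i + 1) \<and> \<sigma> i \<in> X \<and> \<sigma> (i + 1) \<in> Y"
  have "word_des X Y (map \<sigma> [1..<Suc n]) = (\<Sum>i<n - 1. of_bool (?Q (Suc i)))"
    by (simp add: word_des_conv_sum del: upt_Suc)
  also have "\<dots> = (\<Sum>i\<in>{1..<n}. of_bool (?Q i))"
    by (rule sum.reindex_bij_witness[of _ "\<lambda>i. i - 1" Suc]) auto
  also have "\<dots> = card {i \<in> {1..<n}. ?Q i}"
    by (simp add: of_bool_def sum.If_cases Int_def)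
  also have "{i \<in> {1..<n}. ?Q i} = {i. 1 \<le> i \<and> i < n \<and> ?Q i}"
    by auto
  finally show ?thesis
    by (simp add: des_def)
qed

text \<open>Injectivity holds since permutations of \<open>{1..n}\<close> are the identity
  elsewhere; surjectivity follows by counting, as both sets have n! elements.\<close>

lemma bij_betw_permutes_words:
  "bij_betw (\<lambda>\<sigma>. map \<sigma> [1..<Suc n]) {\<sigma>. \<sigma> permutes {1..n}} (permutations_of_set {1..n})"
proof -
  let ?f = "\<lambda>\<sigma>. map \<sigma> [1..<Suc n]"
  have inj: "inj_on ?f {\<sigma>. \<sigma> permutes {1..n}}"
  proof (rule inj_onI, clarify)
    fix \<sigma> \<tau> assume *: "\<sigma> permutes {1..n}" "\<tau> permutes {1..n}" "?f \<sigma> = ?f \<tau>"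
    show "\<sigma> = \<tau>"
    proof
      fix i show "\<sigma> i = \<tau> i"
      proof (cases "i \<in> {1..n}")
        case True
        then show ?thesis using *(3) by (simp del: upt_Suc)
      qed (use *(1,2) in \<open>simp add: permutes_not_in\<close>)
    qed
  qed
  have sub: "?f ` {\<sigma>. \<sigma> permutes {1..n}} \<subseteq> permutations_of_set {1..n}"
  proof clarify
    fix \<sigma> assume \<sigma>: "\<sigma> permutes {1..n}"
    have "[1..<Suc n] \<in> permutations_of_set {1..n}"
      by (auto simp del: upt_Suc)
    then show "?f \<sigma> \<in> permutations_of_set {1..n}"
      using permutations_of_set_image_permutes[OF \<sigma>] by blast
  qed
  have "card (?f ` {\<sigma>. \<sigma> permutes {1..n}}) = card (permutations_of_set {1..n})"
    by (simp only: card_image[OF inj]) (simp add: card_permutations[OF refl])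
  with sub have "?f ` {\<sigma>. \<sigma> permutes {1..n}} = permutations_of_set {1..n}"
    by (intro card_subset_eq) auto
  with inj show ?thesis
    by (simp add: bij_betw_def)
qed

lemma P_conv_words: "P X Y n s = card {xs \<in> permutations_of_set {1..n}. word_des X Y xs = s}"
proof -
  have "bij_betw (\<lambda>\<sigma>. map \<sigma> [1..<Suc n]) {\<sigma> \<in> {\<sigma>. \<sigma> permutes {1..n}}. des X Y n \<sigma> = s}
          {xs \<in> permutations_of_set {1..n}. word_des X Y xs = s}"
  proof (rule bij_betw_Collect[OF bij_betw_permutes_words])
    fix \<sigma> assume "\<sigma> \<in> {\<sigma>. \<sigma> permutes {1..n}}"
    show "(word_des X Y (map \<sigma> [1..<Suc n]) = s) = (des X Y n \<sigma> = s)"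
      by (simp only: word_des_map_upt)
  qed
  then show ?thesis
    by (simp add: P_def bij_betw_same_card)
qed

section \<open>Insertion of a new letter\<close>

lemma sum_permutations_of_set_insert:
  assumes "finite A" "m \<notin> A"
  shows "(\<Sum>ys\<in>permutations_of_set (insert m A). f ys) =
           (\<Sum>xs\<in>permutations_of_set A. \<Sum>i\<le>card A. f (insert_at m i xs))"
proof -
  have "(\<Sum>xs\<in>permutations_of_set A. \<Sum>i\<le>card A. f (insert_at m i xs)) =
          (\<Sum>(xs, i)\<in>permutations_of_set A \<times> {..card A}. f (insert_at m i xs))"
    by (simp add: sum.cartesian_product)
  also have "\<dots> = (\<Sum>ys\<in>permutations_of_set (insert m A). f ys)"
  \<comment> \<open>As \<open>m\<close> occurs just once, deleting it and recording the length of
    the prefix before it recovers the word and the place.\<close>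
  proof (rule sum.reindex_bij_witness[of _
        "\<lambda>ys. (remove1 m ys, length (takeWhile (\<lambda>y. y \<noteq> m) ys))" "\<lambda>(xs, i). insert_at m i xs"])
    fix p assume "p \<in> permutations_of_set A \<times> {..card A}"
    then obtain xs i where p: "p = (xs, i)" "set xs = A" "distinct xs" "i \<le> length xs"
      by (auto simp: permutations_of_set_def distinct_card)
    have t: "m \<notin> set (take i xs)" "m \<notin> set (drop i xs)"
      using assms(2) p(2) by (auto dest: in_set_takeD in_set_dropD)
    have "remove1 m (insert_at m i xs) = xs"
      using t by (simp add: insert_at_def remove1_append)
    moreover have "takeWhile (\<lambda>y. y \<noteq> m) (insert_at m i xs) = take i xs"
      unfolding insert_at_def using t by (subst takeWhile_append2) auto
    ultimately show "(\<lambda>ys. (remove1 m ys, length (takeWhile (\<lambda>y. y \<noteq> m) ys)))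
        ((\<lambda>(xs, i). insert_at m i xs) p) = p"
      using p by simp
    have "set (insert_at m i xs) = insert m (set (take i xs @ drop i xs))"
      unfolding insert_at_def by (simp del: append_take_drop_id)
    moreover have "distinct (insert_at m i xs) \<longleftrightarrow> distinct (take i xs @ drop i xs)"
      unfolding insert_at_def using t by (auto simp del: append_take_drop_id)
    ultimately show "(\<lambda>(xs, i). insert_at m i xs) p \<in> permutations_of_set (insert m A)"
      using p by (auto simp: permutations_of_set_def)
  next
    fix ys assume "ys \<in> permutations_of_set (insert m A)"
    then have ys: "set ys = insert m A" "distinct ys"
      by (auto simp: permutations_of_set_def)
    obtain us vs where uv: "ys = us @ m # vs" "m \<notin> set us"
      using split_list_first[of m ys] ys(1) by auto
    have r: "remove1 m ys = us @ vs" "takeWhile (\<lambda>y. y \<noteq> m) ys = us"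
      using uv by (auto simp: remove1_append takeWhile_append)
    show "(\<lambda>(xs, i). insert_at m i xs)
        (remove1 m ys, length (takeWhile (\<lambda>y. y \<noteq> m) ys)) = ys"
      unfolding r using uv by (simp add: insert_at_def)
    have *: "set (us @ vs) = A" "distinct (us @ vs)"
      using ys uv assms(2) by auto
    have "length us \<le> card A"
      using distinct_card[OF *(2)] *(1) by simp
    with * show "(remove1 m ys, length (takeWhile (\<lambda>y. y \<noteq> m) ys))
        \<in> permutations_of_set A \<times> {..card A}"
      unfolding r by (auto simp: permutations_of_set_def)
  qed auto
  finally show ?thesis by simp
qed

abbreviation des_monom :: "nat set \<Rightarrow> nat set \<Rightarrow> nat list \<Rightarrow> int fps" where
  "des_monom X Y xs \<equiv> fps_X ^ word_des X Y xs"

lemma fps_deriv_fps_X_times: "fps_deriv (fps_X * f) = f + fps_X * fps_deriv (f :: int fps)"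
  by simp

text \<open>Write t for \<open>fps_X\<close>, d for the number of descents of \<open>x # xs\<close>
  and l for the length of \<open>xs\<close>. No place creates a descent, and exactly the d places
  inside a descent destroy one, so the sum is d t^(d-1) + (l+1-d) t^d. Keeping \<open>x\<close> in
  front lets the induction track the first adjacent pair.\<close>

lemma sum_insert_at_tail_notin:
  assumes "m \<notin> X" "x < m" "\<And>z. z \<in> set xs \<Longrightarrow> z < m"
  shows "(\<Sum>i\<le>length xs. des_monom X Y (x # insert_at m i xs)) =
           (1 - fps_X) * fps_deriv (des_monom X Y (x # xs)) +
           of_nat (length xs + 1) * des_monom X Y (x # xs)"
  using assms(2,3)
proof (induction xs arbitrary: x)
  case (Cons y xs)
  have IH: "(\<Sum>i\<le>length xs. des_monom X Y (y # insert_at m i xs)) =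
           (1 - fps_X) * fps_deriv (des_monom X Y (y # xs)) +
           of_nat (length xs + 1) * des_monom X Y (y # xs)"
    using Cons.prems by (intro Cons.IH) auto
  define T where "T = des_monom X Y (y # xs)"
  define b where "b = (x > y \<and> x \<in> X \<and> y \<in> Y)"
  \<comment> \<open>Place 0 separates \<open>x\<close> from \<open>y\<close>, so no factor from
    \<open>b\<close> appears. If \<open>b\<close> holds, the extra term of the product rule for
    \<open>fps_X * T\<close> accounts for this.\<close>
  have T0: "des_monom X Y (x # m # y # xs) = T"
    using Cons.prems assms(1) by (simp add: T_def)
  have "(\<Sum>i\<le>length xs. des_monom X Y (x # y # insert_at m i xs)) =
          fps_X ^ of_bool b * (\<Sum>i\<le>length xs. des_monom X Y (y # insert_at m i xs))"
    by (simp add: sum_distrib_left power_add b_def)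
  then have "(\<Sum>i\<le>length (y # xs). des_monom X Y (x # insert_at m i (y # xs))) =
      T + fps_X ^ of_bool b * ((1 - fps_X) * fps_deriv T + of_nat (length xs + 1) * T)"
    unfolding IH T_def[symmetric]
    by (simp add: sum.atMost_Suc_shift T0 del: sum.atMost_Suc word_des.simps)
  moreover have "des_monom X Y (x # y # xs) = fps_X ^ of_bool b * T"
    by (simp add: power_add b_def T_def)
  ultimately show ?case
    by (cases b) (simp_all add: fps_deriv_fps_X_times algebra_simps)
qed simp

text \<open>Only the place in front of the first letter is new, and there \<open>m\<close> changes
  nothing.\<close>

lemma sum_insert_at_notin:
  assumes "m \<notin> X" "\<And>z. z \<in> set xs \<Longrightarrow> z < m"
  shows "(\<Sum>i\<le>length xs. des_monom X Y (insert_at m i xs)) =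
           (1 - fps_X) * fps_deriv (des_monom X Y xs) +
           of_nat (length xs + 1) * des_monom X Y xs"
proof (cases xs)
  case (Cons y ys)
  have "des_monom X Y (m # y # ys) = des_monom X Y (y # ys)"
    using assms(1) by simp
  moreover have "(\<Sum>i\<le>length ys. des_monom X Y (y # insert_at m i ys)) =
           (1 - fps_X) * fps_deriv (des_monom X Y (y # ys)) +
           of_nat (length ys + 1) * des_monom X Y (y # ys)"
    using assms Cons by (intro sum_insert_at_tail_notin) auto
  ultimately show ?thesis
    unfolding Cons
    by (simp add: sum.atMost_Suc_shift algebra_simps del: sum.atMost_Suc word_des.simps)
qed simp

text \<open>Let k letters of \<open>xs\<close> lie in \<open>Y\<close>, with t, d and l as before. A
  descent is gained at the k-d places before a letter of \<open>Y\<close> that is not a descent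
  bottom, and elsewhere the number is kept: the sum is (k-d) t^(d+1) + (l+1-k+d) t^d.\<close>

lemma sum_insert_at_tail_in:
  assumes "m \<in> X" "x < m" "\<And>z. z \<in> set xs \<Longrightarrow> z < m"
  shows "(\<Sum>i\<le>length xs. des_monom X Y (x # insert_at m i xs)) =
           fps_X * (1 - fps_X) * fps_deriv (des_monom X Y (x # xs)) +
           (of_nat (length (filter (\<lambda>z. z \<in> Y) xs)) * (fps_X - 1) + of_nat (length xs + 1)) *
             des_monom X Y (x # xs)"
  using assms(2,3)
proof (induction xs arbitrary: x)
  case (Cons y xs)
  define k where "k = length (filter (\<lambda>z. z \<in> Y) xs)"
  have IH: "(\<Sum>i\<le>length xs. des_monom X Y (y # insert_at m i xs)) =
           fps_X * (1 - fps_X) * fps_deriv (des_monom X Y (y # xs)) +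
           (of_nat k * (fps_X - 1) + of_nat (length xs + 1)) * des_monom X Y (y # xs)"
    unfolding k_def using Cons.prems by (intro Cons.IH) auto
  define T where "T = des_monom X Y (y # xs)"
  define b where "b = (x > y \<and> x \<in> X \<and> y \<in> Y)"
  have T0: "des_monom X Y (x # m # y # xs) = fps_X ^ of_bool (y \<in> Y) * T"
    using Cons.prems assms(1) by (simp add: T_def)
  have "(\<Sum>i\<le>length xs. des_monom X Y (x # y # insert_at m i xs)) =
          fps_X ^ of_bool b * (\<Sum>i\<le>length xs. des_monom X Y (y # insert_at m i xs))"
    by (simp add: sum_distrib_left power_add b_def)
  then have "(\<Sum>i\<le>length (y # xs). des_monom X Y (x # insert_at m i (y # xs))) =
      fps_X ^ of_bool (y \<in> Y) * T + fps_X ^ of_bool b *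
        (fps_X * (1 - fps_X) * fps_deriv T +
         (of_nat k * (fps_X - 1) + of_nat (length xs + 1)) * T)"
    unfolding IH T_def[symmetric]
    by (simp add: sum.atMost_Suc_shift T0 del: sum.atMost_Suc word_des.simps)
  moreover have "des_monom X Y (x # y # xs) = fps_X ^ of_bool b * T"
    by (simp add: power_add b_def T_def)
  moreover have "length (filter (\<lambda>z. z \<in> Y) (y # xs)) = of_bool (y \<in> Y) + k"
    by (simp add: k_def)
  \<comment> \<open>This excludes the case of \<open>b\<close> with \<open>y\<close> outside
    \<open>Y\<close>, in which the two sides would differ.\<close>
  moreover have "b \<Longrightarrow> y \<in> Y"
    by (simp add: b_def)
  ultimately show ?case
    by (cases b; cases "y \<in> Y") (simp_all add: fps_deriv_fps_X_times algebra_simps)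
qed simp

text \<open>In front, \<open>m\<close> gains a descent exactly if the first letter is in
  \<open>Y\<close>, which extends the count of such letters from the tail to the whole word.\<close>

lemma sum_insert_at_in:
  assumes "m \<in> X" "\<And>z. z \<in> set xs \<Longrightarrow> z < m"
  shows "(\<Sum>i\<le>length xs. des_monom X Y (insert_at m i xs)) =
           fps_X * (1 - fps_X) * fps_deriv (des_monom X Y xs) +
           (of_nat (length (filter (\<lambda>z. z \<in> Y) xs)) * (fps_X - 1) + of_nat (length xs + 1)) *
             des_monom X Y xs"
proof (cases xs)
  case (Cons y ys)
  have "des_monom X Y (m # y # ys) = fps_X ^ of_bool (y \<in> Y) * des_monom X Y (y # ys)"
    using assms Cons by (simp add: power_add)
  moreover have "(\<Sum>i\<le>length ys. des_monom X Y (y # insert_at m i ys)) =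
           fps_X * (1 - fps_X) * fps_deriv (des_monom X Y (y # ys)) +
           (of_nat (length (filter (\<lambda>z. z \<in> Y) ys)) * (fps_X - 1) + of_nat (length ys + 1)) *
             des_monom X Y (y # ys)"
    using assms Cons by (intro sum_insert_at_tail_in) auto
  ultimately show ?thesis
    unfolding Cons
    by (cases "y \<in> Y")
       (simp_all add: sum.atMost_Suc_shift algebra_simps del: sum.atMost_Suc word_des.simps)
qed simp

subsection \<open>Recurrences for the generating functions\<close>

text \<open>A power series rather than a \<open>poly\<close>, for direct comparison with an infinite
  series.\<close>

definition des_poly :: "nat set \<Rightarrow> nat set \<Rightarrow> nat \<Rightarrow> int fps" where
  "des_poly X Y n = (\<Sum>xs\<in>permutations_of_set {1..n}. des_monom X Y xs)"

lemma des_poly_nth: "fps_nth (des_poly X Y n) s = int (P X Y n s)"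
proof -
  have "fps_nth (des_poly X Y n) s =
          int (card {xs \<in> permutations_of_set {1..n}. s = word_des X Y xs})"
    by (simp add: des_poly_def fps_sum_nth sum.If_cases Int_def)
  also have "\<dots> = int (P X Y n s)"
    by (simp only: P_conv_words eq_commute[of s])
  finally show ?thesis .
qed

lemma des_poly_0: "des_poly X Y 0 = 1"
  by (simp add: des_poly_def)

lemma des_poly_Suc_notin:
  assumes "Suc n \<notin> X"
  shows "des_poly X Y (Suc n) =
           (1 - fps_X) * fps_deriv (des_poly X Y n) + of_nat (n + 1) * des_poly X Y n"
proof -
  have "des_poly X Y (Suc n) =
          (\<Sum>xs\<in>permutations_of_set {1..n}. \<Sum>i\<le>n. des_monom X Y (insert_at (Suc n) i xs))"
    unfolding des_poly_def by (simp add: atLeastAtMostSuc_conv sum_permutations_of_set_insert)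
  also have "\<dots> = (\<Sum>xs\<in>permutations_of_set {1..n}.
      (1 - fps_X) * fps_deriv (des_monom X Y xs) + of_nat (n + 1) * des_monom X Y xs)"
  proof (rule sum.cong)
    fix xs assume xs: "xs \<in> permutations_of_set {1..n}"
    have len: "length xs = n"
      using length_finite_permutations_of_set[OF xs] by simp
    show "(\<Sum>i\<le>n. des_monom X Y (insert_at (Suc n) i xs)) =
      (1 - fps_X) * fps_deriv (des_monom X Y xs) + of_nat (n + 1) * des_monom X Y xs"
      using sum_insert_at_notin[of "Suc n" X xs Y] assms permutations_of_setD(1)[OF xs] len
      by (simp add: less_Suc_eq_le)
  qed simp
  finally show ?thesis
    by (simp add: des_poly_def fps_deriv_sum sum.distrib sum_distrib_left)
qed

lemma des_poly_Suc_in: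
  assumes "Suc n \<in> X"
  shows "des_poly X Y (Suc n) =
           fps_X * (1 - fps_X) * fps_deriv (des_poly X Y n) +
           (of_nat (card (Y \<inter> {1..n})) * (fps_X - 1) + of_nat (n + 1)) * des_poly X Y n"
proof -
  let ?c = "of_nat (card (Y \<inter> {1..n})) * (fps_X - 1) + of_nat (n + 1) :: int fps"
  have "des_poly X Y (Suc n) =
          (\<Sum>xs\<in>permutations_of_set {1..n}. \<Sum>i\<le>n. des_monom X Y (insert_at (Suc n) i xs))"
    unfolding des_poly_def by (simp add: atLeastAtMostSuc_conv sum_permutations_of_set_insert)
  also have "\<dots> = (\<Sum>xs\<in>permutations_of_set {1..n}.
      fps_X * (1 - fps_X) * fps_deriv (des_monom X Y xs) + ?c * des_monom X Y xs)"
  proof (rule sum.cong)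
    fix xs assume xs: "xs \<in> permutations_of_set {1..n}"
    have len: "length xs = n"
      using length_finite_permutations_of_set[OF xs] by simp
    have set: "set xs = {1..n}"
      using permutations_of_setD(1)[OF xs] .
    \<comment> \<open>The number of letters in \<open>Y\<close> is the same for all words, so its
      factor leaves the outer sum.\<close>
    have "set (filter (\<lambda>z. z \<in> Y) xs) = Y \<inter> {1..n}"
      unfolding set_filter set by blast
    then have filter: "length (filter (\<lambda>z. z \<in> Y) xs) = card (Y \<inter> {1..n})"
      using distinct_card[of "filter (\<lambda>z. z \<in> Y) xs"] permutations_of_setD(2)[OF xs] by simp
    have less: "z < Suc n" if "z \<in> set xs" for z
      using that by (simp add: set)
    from sum_insert_at_in[where Y = Y and xs = xs, OF assms less]
    show "(\<Sum>i\<le>n. des_monom X Y (insert_at (Suc n) i xs)) =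
      fps_X * (1 - fps_X) * fps_deriv (des_monom X Y xs) + ?c * des_monom X Y xs"
      unfolding len filter by simp
  qed simp
  finally show ?thesis
    by (simp add: des_poly_def fps_deriv_sum sum.distrib sum_distrib_left)
qed

section \<open>Recurrences for the coefficients of the closed form\<close>

definition des_coeff :: "nat set \<Rightarrow> nat set \<Rightarrow> nat \<Rightarrow> nat \<Rightarrow> int" where
  "des_coeff X Y n r =
     fact (card (restr_compl X n)) * int ((card (restr_compl X n) + r) choose r) *
     (\<Prod>x\<in>restr X n. int (1 + r + alpha X n x + beta Y n x))"

lemma des_coeff_0: "des_coeff X Y 0 r = 1"
  by (simp add: des_coeff_def restr_def restr_compl_def)

text \<open>Both sides are (r+1)(r+2)...(r+a+1), because a! times the binomial coefficient of a+r
  over r is (r+1)...(r+a).\<close>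

lemma fact_Suc_times_choose:
  "fact (Suc a) * (Suc a + r choose r) = (r + 1) * (fact a * (a + Suc r choose Suc r) :: nat)"
proof -
  have "Suc r * (Suc (a + r) choose Suc r) = Suc a * (Suc (a + r) choose r)"
    using binomial_absorb_comp[of "Suc (a + r)" r] Suc_times_binomial_eq[of "a + r" r]
    by (simp only: Suc_diff_le le_add2 diff_add_inverse2 diff_Suc_1 mult.commute)
  then have "(r + 1) * (a + Suc r choose Suc r) = Suc a * (Suc a + r choose r)"
    by (simp only: add_Suc add_Suc_right Suc_eq_plus1[symmetric])
  then show ?thesis
    by (simp only: fact_Suc of_nat_id mult_ac)
qed

text \<open>The new element of the complement raises every \<open>alpha\<close> by one, which
  amounts to replacing \<open>r\<close> by \<open>r + 1\<close> in the product.\<close>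

lemma des_coeff_Suc_notin:
  assumes "Suc n \<notin> X"
  shows "des_coeff X Y (Suc n) r = int (r + 1) * des_coeff X Y n (r + 1)"
proof -
  have "restr_compl X (Suc n) = insert (Suc n) (restr_compl X n)"
    using assms by (auto simp: restr_compl_def)
  then have a: "card (restr_compl X (Suc n)) = Suc (card (restr_compl X n))"
    by (simp add: restr_compl_def)
  have restr: "restr X (Suc n) = restr X n"
    using assms by (auto simp: restr_def le_Suc_eq)
  have alpha: "alpha X (Suc n) x = Suc (alpha X n x)" if "x \<in> restr X n" for x
  proof -
    have "{z. x < z \<and> z \<le> Suc n \<and> z \<notin> X} = insert (Suc n) {z. x < z \<and> z \<le> n \<and> z \<notin> X}"
      using that assms by (auto simp: restr_def)
    then show ?thesis by (simp add: alpha_def)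
  qed
  have "(\<Prod>x\<in>restr X (Suc n). int (1 + r + alpha X (Suc n) x + beta Y (Suc n) x)) =
        (\<Prod>x\<in>restr X n. int (1 + (r + 1) + alpha X n x + beta Y n x))"
    unfolding restr by (rule prod.cong) (simp_all add: alpha beta_def)
  moreover have "fact (Suc (card (restr_compl X n))) *
      int ((Suc (card (restr_compl X n)) + r) choose r) =
      int (r + 1) * (fact (card (restr_compl X n)) * int (card (restr_compl X n) + Suc r choose Suc r))"
    using arg_cong[OF fact_Suc_times_choose, of int "card (restr_compl X n)" r]
    by (simp only: of_nat_mult of_nat_fact)
  ultimately show ?thesis
    unfolding des_coeff_def a by (simp only: Suc_eq_plus1 mult.assoc)
qed

text \<open>The old factors stay the same; the new one belongs to \<open>x = Suc n\<close>, where
  \<open>alpha\<close> is 0 and \<open>beta\<close> counts the elements of \<open>{1..n}\<close>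
  outside \<open>Y\<close>.\<close>

lemma des_coeff_Suc_in:
  assumes "Suc n \<in> X"
  shows "des_coeff X Y (Suc n) r = int (1 + r + n - card (Y \<inter> {1..n})) * des_coeff X Y n r"
proof -
  have compl: "restr_compl X (Suc n) = restr_compl X n"
    using assms by (auto simp: restr_compl_def le_Suc_eq)
  have restr: "restr X (Suc n) = insert (Suc n) (restr X n)"
    using assms by (auto simp: restr_def)
  have alpha: "alpha X (Suc n) x = alpha X n x" for x
    using assms by (auto simp: alpha_def le_Suc_eq intro!: arg_cong[where f = card])
  have alpha0: "alpha X n (Suc n) = 0"
    by (auto simp: alpha_def)
  have "{z. 1 \<le> z \<and> z < Suc n \<and> z \<notin> Y} = {1..n} - Y \<inter> {1..n}"
    by auto
  then have beta: "beta Y (Suc n) (Suc n) = n - card (Y \<inter> {1..n})"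
    by (simp add: beta_def card_Diff_subset)
  \<comment> \<open>This bound lets the truncated subtraction in \<open>beta\<close> be moved past
    the summand \<open>1 + r\<close>.\<close>
  have le: "card (Y \<inter> {1..n}) \<le> n"
    using card_mono[of "{1..n}" "Y \<inter> {1..n}"] by simp
  have "(\<Prod>x\<in>restr X (Suc n). int (1 + r + alpha X (Suc n) x + beta Y (Suc n) x)) =
        int (1 + r + n - card (Y \<inter> {1..n})) *
        (\<Prod>x\<in>restr X n. int (1 + r + alpha X n x + beta Y n x))"
  proof -
    have "beta Y (Suc n) x = beta Y n x" for x
      by (simp add: beta_def)
    then show ?thesis
      unfolding restr alpha using le beta alpha0
      by (subst prod.insert) (auto simp: restr_def)
  qed
  then show ?thesis
    unfolding des_coeff_def compl by (simp only: mult_ac)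
qed

section \<open>Comparison of the series and extraction of coefficients\<close>

lemma des_poly_eq: "des_poly X Y n = (1 - fps_X) ^ (n + 1) * Abs_fps (des_coeff X Y n)"
proof (induction n)
  case 0
  \<comment> \<open>For \<open>n = 0\<close> the claim is the geometric series.\<close>
  have "(1 - fps_X) * Abs_fps (\<lambda>_. 1 :: int) = 1"
    by (rule fps_ext) (auto simp: left_diff_distrib)
  then show ?case
    by (simp add: des_poly_0 des_coeff_0[abs_def])
next
  case (Suc n)
  define G where "G = Abs_fps (des_coeff X Y n)"
  \<comment> \<open>The derivative lowers the power of \<open>1 - fps_X\<close> to \<open>n\<close>;
    with \<open>Q\<close> as common factor, both cases end in ring algebra.\<close>
  define Q :: "int fps" where "Q = (1 - fps_X) ^ n"
  have IH: "des_poly X Y n = (1 - fps_X) * Q * G"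
    using Suc by (simp add: G_def Q_def)
  have "fps_deriv ((1 - fps_X) ^ (n + 1)) = - of_nat (n + 1) * Q"
    by (subst fps_deriv_power') (simp add: Q_def)
  then have "fps_deriv ((1 - fps_X) ^ (n + 1) * G) =
      (1 - fps_X) ^ (n + 1) * fps_deriv G - of_nat (n + 1) * Q * G"
    by (simp only: fps_deriv_mult mult_minus_left add_uminus_conv_diff)
  then have deriv: "fps_deriv (des_poly X Y n) =
      (1 - fps_X) * Q * fps_deriv G - of_nat (n + 1) * Q * G"
    unfolding IH by (simp only: Q_def Suc_eq_plus1[symmetric] power_Suc)
  have pow: "(1 - fps_X) ^ (Suc n + 1) = (1 - fps_X) * (1 - fps_X) * Q"
    by (simp add: Q_def)
  show ?case
  proof (cases "Suc n \<in> X")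
    case False
    have "Abs_fps (des_coeff X Y (Suc n)) = fps_deriv G"
      by (rule fps_ext) (simp add: G_def des_coeff_Suc_notin[OF False])
    then show ?thesis
      unfolding des_poly_Suc_notin[OF False] deriv unfolding IH pow by (simp add: algebra_simps)
  next
    case True
    have le: "card (Y \<inter> {1..n}) \<le> n"
      using card_mono[of "{1..n}" "Y \<inter> {1..n}"] by simp
    \<comment> \<open>In the factor 1+r+n-y, with y the cardinality in \<open>le\<close>, the part r
      comes from \<open>fps_X * fps_deriv G\<close> and the rest is constant in r.\<close>
    have G: "Abs_fps (des_coeff X Y (Suc n)) =
        fps_X * fps_deriv G + (of_nat (n + 1) - of_nat (card (Y \<inter> {1..n}))) * G"
      using le by (intro fps_ext)
        (auto simp: G_def des_coeff_Suc_in[OF True] fps_of_nat[symmetric] of_nat_diff algebra_simps)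
    show ?thesis
      unfolding des_poly_Suc_in[OF True] deriv G unfolding IH pow by (simp add: algebra_simps)
  qed
qed

lemma one_minus_fps_X_power_nth:
  "fps_nth ((1 - fps_X :: 'a :: comm_ring_1 fps) ^ m) i = (-1) ^ i * of_nat (m choose i)"
proof -
  have "(1 - fps_X :: 'a fps) ^ m = (\<Sum>k\<le>m. of_nat (m choose k) * (- fps_X) ^ k)"
    using binomial_ring[of "- fps_X :: 'a fps" 1 m] by simp
  also have "\<dots> = (\<Sum>k\<le>m. fps_const ((-1) ^ k * of_nat (m choose k)) * fps_X ^ k)"
    by (intro sum.cong)
       (simp_all add: power_minus[of "fps_X :: 'a fps"] fps_of_nat[symmetric] mult_ac
          fps_const_power[symmetric] fps_const_neg[symmetric] flip: fps_const_mult)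
  also have "fps_nth \<dots> i = (-1) ^ i * of_nat (m choose i)"
    by (auto simp: fps_sum_nth if_distrib[of "\<lambda>x. _ * x"] binomial_eq_0 cong: if_cong)
  finally show ?thesis .
qed

theorem theorem2p3:
  fixes X Y :: "nat set" and n s :: nat
  assumes "X \<subseteq> {1..}" and "Y \<subseteq> {1..}" and "n \<ge> 1"
  shows "int (P X Y n s) =
    fact (card (restr_compl X n)) *
    (\<Sum>r = 0..s. (- 1) ^ (s - r) *
       int ((card (restr_compl X n) + r) choose r) *
       int ((n + 1) choose (s - r)) *
       (\<Prod>x\<in>restr X n. int (1 + r + alpha X n x + beta Y n x)))"
proof -
  \<comment> \<open>The factors are swapped so that \<open>r\<close> indexes
    \<open>des_coeff\<close> in the convolution and \<open>s - r\<close> the power of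
    \<open>1 - fps_X\<close>.\<close>
  have "int (P X Y n s) = fps_nth (Abs_fps (des_coeff X Y n) * (1 - fps_X) ^ (n + 1)) s"
    by (simp only: des_poly_nth[symmetric] des_poly_eq mult.commute)
  also have "\<dots> = (\<Sum>r = 0..s. des_coeff X Y n r * ((- 1) ^ (s - r) * int ((n + 1) choose (s - r))))"
    by (simp only: fps_mult_nth one_minus_fps_X_power_nth fps_nth_Abs_fps)
  finally show ?thesis
    by (simp only: des_coeff_def sum_distrib_left mult_ac)
qed

end
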